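(* Let $\mathcal{H}$ be a finite-dimensional Euclidean space, $(\Omega,\mathcal{F},\mathbb{P})$ a probability space with a filtration $(\mathcal{F}_k)_{k\in\mathbb{N}}$, $(\mathbf{x}_k)_{k\in\mathbb{N}}$ a stochastic process with values in $\mathcal{H}$, and $\chi_\infty$ its (random) set of accumulation points. Let $V:\mathcal{H}\to\mathbb{R}$ and $\Gamma\subset\mathcal{H}$ be such that: (1) $V$ is coercive and continuously differentiable; (2) $\Gamma$ is a deterministic non-empty subset of $\mathcal{H}$ with $|V(\Gamma)|<+\infty$, and almost surely $\Gamma\cap\chi_\infty\neq\emptyset$; (3) $V$ satisfies the Kurdyka-Lojasiewicz (KL) property on $\mathcal{H}$, and there is a positive integer $I<+\infty$ such that $\Gamma=\bigcup_{i=1}^I C_i$, where each $C_i$ is a compact set on which $V$ is constant; (4) $(V(\mathbf{x}_k))_{k\in\mathbb{N}}$ is an $(\mathcal{F}_k)$-supermartingale. Under (1) and (4), $(V(\mathbf{x}_k))_{k\in\mathbb{N}}$ converges almost surely to an integrable random variable $V_\infty$. Assume that for every $k\in\mathbb{N}$, $\|\nabla V(\mathbf{x}_k)\|_{\mathcal{H}}>0$, and that for every $k\in\mathbb{N}$ either $$V(\mathbf{x}_k)\geq \mathbb{E}[V_\infty|\mathcal{F}_k]>V_\infty\ \text{ a.s.}\qquad\text{or}\qquad V(\mathbf{x}_k)>\mathbb{E}[V_\infty|\mathcal{F}_k]\geq V_\infty\ \text{ a.s.}$$ Then: (i) There exist $\varphi\in\Phi_{+\infty}$ and an almost surely finite discrete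 positive random variable $K$ such that $$\mathbb{E}[D]\leq \mathbb{E}[\varphi(V(\mathbf{x}_0)-V_\infty)],\qquad\text{where } D:=\sum_{k=K+1}^{+\infty}\frac{V(\mathbf{x}_k)-\mathbb{E}[V(\mathbf{x}_{k+1})|\mathcal{F}_k]}{\|\nabla V(\mathbf{x}_k)\|_{\mathcal{H}}}.$$ (ii) Almost surely, $$\sum_{k=0}^{+\infty}\frac{V(\mathbf{x}_k)-\mathbb{E}[V(\mathbf{x}_{k+1})|\mathcal{F}_k]}{\|\nabla V(\mathbf{x}_k)\|_{\mathcal{H}}}<+\infty.$$
   Context: A function $f:\mathcal{H}\to\mathbb{R}$ is coercive if $f(\mathbf{x})\to+\infty$ as $\|\mathbf{x}\|\to+\infty$. $|E|$ denotes the cardinality of a set $E$. For $\zeta\in(0,+\infty]$, $\Phi_\zeta$ denotes the set of concave functions $\varphi:[0,\zeta)\to\mathbb{R}_+$ such that $\varphi(0)=0$, $\varphi$ is continuous at $0$, $\varphi\in C^1((0,\zeta))$ and $\varphi'(s)>0$ for every $s\in(0,\zeta)$. A differentiable function $f:\mathcal{H}\to\mathbb{R}$ satisfies the KL property at $\widetilde{\mathbf{x}}\in\mathcal{H}$ if there exist a neighbourhood $\mathcal{V}$ of $\widetilde{\mathbf{x}}$, $\zeta>0$ and $\varphi\in\Phi_\zeta$ such that $\|\nabla f(\mathbf{x})\|_{\mathcal{H}}\,\varphi'(f(\mathbf{x})-f(\widetilde{\mathbf{x}}))\geq 1$ for every $\mathbf{x}\in\mathcal{V}$ with $0<f(\mathbf{x})-f(\widetilde{\mathbf{x}})<\zeta$.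 It satisfies the KL property on $E\subset\mathcal{H}$ if it does so at every point of $E$. *)

theory Defs
  imports "HOL-Probability.Probability" "HOL-Library.Extended_Nat"
begin

definition grad :: "('h::euclidean_space \<Rightarrow> real) \<Rightarrow> 'h \<Rightarrow> 'h" where
  "grad f x = (THE g. GDERIV f x :> g)"

lemma grad_eqI:
  assumes "GDERIV f x :> g"
  shows "grad f x = g"
  unfolding grad_def
proof (rule the_equality)
  show "GDERIV f x :> g" by fact
  fix g' assume "GDERIV f x :> g'"
  then have "(\<lambda>h. inner h g') = (\<lambda>h. inner h g)"
    using assms by (auto simp: gderiv_def intro: has_derivative_unique)
  then show "g' = g"
    by (metis inner_commute vector_eq_ldot)
qed

lemma differentiable_imp_GDERIV_grad:
  fixes f :: "'h::euclidean_space \<Rightarrow> real"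
  assumes "f differentiable (at x)"
  shows "GDERIV f x :> grad f x"
proof -
  from assms obtain f' where f': "(f has_derivative f') (at x)"
    by (auto simp: differentiable_def)
  then interpret bounded_linear f' by (rule has_derivative_bounded_linear)
  have "f' = (\<lambda>h. inner h (adjoint f' 1))"
    using adjoint_works[OF linear_axioms, of _ 1] by auto
  with f' have "GDERIV f x :> adjoint f' 1" by (simp add: gderiv_def)
  then show ?thesis by (simp add: grad_eqI)
qed

definition continuously_differentiable :: "('h::euclidean_space \<Rightarrow> real) \<Rightarrow> bool" where
  "continuously_differentiable f \<longleftrightarrow>
     (\<forall>x. f differentiable (at x)) \<and> continuous_on UNIV (grad f)"

definition coercive :: "('h::euclidean_space \<Rightarrow> real) \<Rightarrow> bool" where
  "coercive f \<longleftrightarrow> filterlim f at_top at_infinity"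

text \<open>The class \<open>\<Phi>\<^sub>\<zeta>\<close>. The extended real \<open>\<zeta>\<close> may be \<open>\<infinity>\<close>. Functions are total here; their values
  outside \<open>[0, \<zeta>)\<close> are unconstrained.\<close>

definition Phi :: "ereal \<Rightarrow> (real \<Rightarrow> real) set" where
  "Phi \<zeta> = {\<phi>.
     concave_on {s. 0 \<le> s \<and> ereal s < \<zeta>} \<phi> \<and>
     (\<forall>s. 0 \<le> s \<and> ereal s < \<zeta> \<longrightarrow> 0 \<le> \<phi> s) \<and>
     \<phi> 0 = 0 \<and>
     continuous (at 0 within {s. 0 \<le> s \<and> ereal s < \<zeta>}) \<phi> \<and>
     \<phi> C1_differentiable_on {s. 0 < s \<and> ereal s < \<zeta>} \<and>
     (\<forall>s. 0 < s \<and> ereal s < \<zeta> \<longrightarrow> 0 < deriv \<phi> s)}"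

definition KL_at :: "('h::euclidean_space \<Rightarrow> real) \<Rightarrow> 'h \<Rightarrow> bool" where
  "KL_at f a \<longleftrightarrow>
     (\<exists>N \<zeta> \<phi>. a \<in> interior N \<and> 0 < \<zeta> \<and> \<phi> \<in> Phi \<zeta> \<and>
        (\<forall>x\<in>N. 0 < f x - f a \<and> ereal (f x - f a) < \<zeta> \<longrightarrow>
           norm (grad f x) * deriv \<phi> (f x - f a) \<ge> 1))"

definition KL_on :: "'h::euclidean_space set \<Rightarrow> ('h \<Rightarrow> real) \<Rightarrow> bool" where
  "KL_on E f \<longleftrightarrow> (\<forall>a\<in>E. KL_at f a)"

text \<open>Accumulation points of a sequence are its subsequential limits (so a value taken infinitely
  often counts), not the limit points of its range.\<close>

definition accumulation_points :: "(nat \<Rightarrow> 'h::topological_space) \<Rightarrow> 'h set" where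
  "accumulation_points s = {y. \<exists>r. strict_mono r \<and> (s \<circ> r) \<longlonglongrightarrow> y}"

definition supermartingale ::
    "'a measure \<Rightarrow> (nat \<Rightarrow> 'a measure) \<Rightarrow> (nat \<Rightarrow> 'a \<Rightarrow> real) \<Rightarrow> bool" where
  "supermartingale M F Y \<longleftrightarrow>
     (\<forall>k. Y k \<in> borel_measurable (F k)) \<and>
     (\<forall>k. integrable M (Y k)) \<and>
     (\<forall>k. AE \<omega> in M. real_cond_exp M (F k) (Y (Suc k)) \<omega> \<le> Y k \<omega>)"

definition drift_ratio ::
    "'a measure \<Rightarrow> (nat \<Rightarrow> 'a measure) \<Rightarrow> ('h::euclidean_space \<Rightarrow> real) \<Rightarrow>
     (nat \<Rightarrow> 'a \<Rightarrow> 'h) \<Rightarrow> nat \<Rightarrow> 'a \<Rightarrow> real" where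
  "drift_ratio M F V x k \<omega> =
     (V (x k \<omega>) - real_cond_exp M (F k) (\<lambda>\<omega>'. V (x (Suc k) \<omega>')) \<omega>) / norm (grad V (x k \<omega>))"

text \<open>The random tail sum over all indices \<open>k > K\<close>. It is valued in \<open>[0, \<infinity>]\<close> so that its
  expectation always exists; when \<open>V \<circ> x\<close> is a supermartingale the summands are almost surely
  nonnegative, so \<open>ennreal\<close> only truncates on a null set.\<close>

definition tail_sum ::
    "'a measure \<Rightarrow> (nat \<Rightarrow> 'a measure) \<Rightarrow> ('h::euclidean_space \<Rightarrow> real) \<Rightarrow>
     (nat \<Rightarrow> 'a \<Rightarrow> 'h) \<Rightarrow> ('a \<Rightarrow> enat) \<Rightarrow> 'a \<Rightarrow> ennreal" where
  "tail_sum M F V x K \<omega> =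
     (\<Sum>k. if K \<omega> < enat k then ennreal (drift_ratio M F V x k \<omega>) else 0)"

end

theory Submission
  imports Defs
begin

text \<open>Write \<open>V\<^sub>k = V (x k)\<close>.  Three observations carry the proof.

  First, the ordering hypothesis determines the limit.  In both of its cases
  \<open>E[V\<^sub>\<infinity> | F k] \<ge> V\<^sub>\<infinity>\<close> almost surely, and both sides have the same mean, so they are equal
  (\<open>real_cond_exp_eq_if_ge\<close>); moreover \<open>V\<^sub>k > V\<^sub>\<infinity>\<close>.  Hence \<open>V\<^sub>\<infinity>\<close> may be treated as known at
  every time, and \<open>Y\<^sub>k = V\<^sub>k - V\<^sub>\<infinity>\<close> is a positive supermartingale tending to \<open>0\<close> with the same
  conditional decrements as \<open>V\<^sub>k\<close>.

  Second, the limit takes finitely many values: it equals \<open>V y\<close> for any accumulation point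
  \<open>y\<close> in \<open>\<Gamma>\<close>.  By coercivity the level sets at these values are compact, so the local KL
  inequalities merge into one: there are a single \<open>\<phi>\<close> in \<open>Phi \<infinity>\<close> and \<open>\<eta> > 0\<close> such that
  \<open>norm (grad V y) * \<phi>' (V y - v) \<ge> 1\<close> whenever \<open>v\<close> is one of the values and
  \<open>0 < V y - v < \<eta>\<close> (\<open>uniform_KL_above_finite_levels\<close>).  Summing desingularizing functions
  achieves this, after each has been continued to \<open>[0, \<infinity>)\<close> along a tangent.

  Third, as soon as \<open>Y\<^sub>k < \<eta>\<close>, concavity of \<open>\<phi>\<close> and the conditional Jensen inequality bound the
  drift ratio by \<open>\<phi> Y\<^sub>k - E[\<phi> Y\<^sub>k\<^sub>+\<^sub>1 | F k]\<close> (\<open>drift_ratio_le_Phi_decrement\<close>).  These bounds are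
  nonnegative and integrable, and their expectations telescope to at most \<open>E[\<phi> Y\<^sub>0]\<close>, which is
  finite because \<open>\<phi>\<close> grows at most linearly.  Taking for \<open>K\<close> a time after which \<open>Y\<^sub>k < \<eta>\<close>
  gives both assertions.

  The existence of \<open>V\<^sub>\<infinity>\<close> is Doob's convergence theorem for supermartingales bounded below.  It
  is proved from an upcrossing estimate, with the trading strategy written as a recursion on the
  path.\<close>

section \<open>Desingularizing functions\<close>

lemma Phi_open_domain: "open {s. 0 < s \<and> ereal s < \<zeta>}"
  by (intro open_Collect_conj open_Collect_less) (auto intro!: continuous_intros)

lemma Phi_has_derivative:
  assumes "\<phi> \<in> Phi \<zeta>" "0 < s" "ereal s < \<zeta>"
  shows "(\<phi> has_real_derivative deriv \<phi> s) (at s)"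
proof -
  obtain D where "\<forall>x\<in>{s. 0 < s \<and> ereal s < \<zeta>}. (\<phi> has_vector_derivative D x) (at x)"
    using assms(1) unfolding Phi_def C1_differentiable_on_def by blast
  then have "(\<phi> has_real_derivative D s) (at s)"
    using assms by (auto simp: has_real_derivative_iff_has_vector_derivative)
  then show ?thesis by (simp add: DERIV_imp_deriv)
qed

lemma Phi_continuous_on_deriv:
  assumes "\<phi> \<in> Phi \<zeta>"
  shows "continuous_on {s. 0 < s \<and> ereal s < \<zeta>} (deriv \<phi>)"
proof -
  obtain D where D: "\<forall>x\<in>{s. 0 < s \<and> ereal s < \<zeta>}. (\<phi> has_vector_derivative D x) (at x)"
    and "continuous_on {s. 0 < s \<and> ereal s < \<zeta>} D"
    using assms unfolding Phi_def C1_differentiable_on_def by blast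
  moreover have "D s = deriv \<phi> s" if "s \<in> {s. 0 < s \<and> ereal s < \<zeta>}" for s
    using D that by (auto simp: has_real_derivative_iff_has_vector_derivative[symmetric]
        intro!: DERIV_imp_deriv[symmetric])
  ultimately show ?thesis by (metis (no_types, lifting) continuous_on_cong)
qed

lemma Phi_deriv_pos: "\<phi> \<in> Phi \<zeta> \<Longrightarrow> 0 < s \<Longrightarrow> ereal s < \<zeta> \<Longrightarrow> 0 < deriv \<phi> s"
  by (simp add: Phi_def)

lemma Phi_below_tangent:
  assumes \<phi>: "\<phi> \<in> Phi \<zeta>" and t: "0 < t" "ereal t < \<zeta>" and s: "0 \<le> s" "ereal s < \<zeta>"
  shows "\<phi> s \<le> \<phi> t + deriv \<phi> t * (s - t)"
proof -
  let ?A = "{s. 0 \<le> s \<and> ereal s < \<zeta>}"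
  have cvx: "convex_on ?A (\<lambda>s. - \<phi> s)"
    using \<phi> by (simp add: Phi_def concave_on_def)
  have "t \<in> interior ?A"
    using t by (intro interiorI[OF Phi_open_domain[of \<zeta>]]) auto
  moreover have "((\<lambda>s. - \<phi> s) has_real_derivative - deriv \<phi> t) (at t within ?A)"
    using Phi_has_derivative[OF \<phi> t]
    by (auto intro!: DERIV_minus intro: has_field_derivative_at_within)
  ultimately have "- \<phi> s - - \<phi> t \<ge> - deriv \<phi> t * (s - t)"
    using s convex_on_imp_convex[OF cvx]
    by (intro convex_on_imp_above_tangent[OF cvx]) (auto intro: convex_connected)
  then show ?thesis by simp
qed

lemma Phi_mono:
  assumes \<phi>: "\<phi> \<in> Phi \<zeta>" and "0 \<le> s" "s \<le> t" "ereal t < \<zeta>"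
  shows "\<phi> s \<le> \<phi> t"
proof (cases "s = t")
  case False
  have "ereal s < \<zeta>" using assms by (meson ereal_less_eq(3) order.strict_trans1)
  then have "\<phi> s \<le> \<phi> t + deriv \<phi> t * (s - t)"
    using Phi_below_tangent[OF \<phi>] assms False by simp
  moreover have "deriv \<phi> t * (s - t) \<le> 0"
    using Phi_deriv_pos[OF \<phi>, of t] assms False by (simp add: mult_le_0_iff)
  ultimately show ?thesis by simp
qed simp

lemma Phi_deriv_antimono:
  assumes \<phi>: "\<phi> \<in> Phi \<zeta>" and "0 < s" "s \<le> t" "ereal t < \<zeta>"
  shows "deriv \<phi> t \<le> deriv \<phi> s"
proof (cases "s = t")
  case False
  have s: "ereal s < \<zeta>" using assms by (meson ereal_less_eq(3) order.strict_trans1)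
  have "\<phi> s \<le> \<phi> t + deriv \<phi> t * (s - t)" "\<phi> t \<le> \<phi> s + deriv \<phi> s * (t - s)"
    using assms s by (auto intro!: Phi_below_tangent[OF \<phi>])
  then have "deriv \<phi> t * (t - s) \<le> deriv \<phi> s * (t - s)"
    by (simp add: algebra_simps)
  then show ?thesis using assms False by simp
qed simp

text \<open>To show concavity it is enough to have a supporting line above the graph at every
  interior point.  For a function glued from two pieces such a line can be written down, whereas
  convex combinations of points on either side of the joint are awkward.\<close>

lemma Phi_infinity_by_tangents:
  assumes "\<phi> 0 = 0" and "continuous (at 0 within {0..}) \<phi>"
    and der: "\<And>t. 0 < t \<Longrightarrow> (\<phi> has_real_derivative D t) (at t)"
    and "continuous_on {0<..} D" and pos: "\<And>t. 0 < t \<Longrightarrow> 0 < D t"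
    and tangent: "\<And>s t. 0 < t \<Longrightarrow> 0 \<le> s \<Longrightarrow> \<phi> s \<le> \<phi> t + D t * (s - t)"
  shows "\<phi> \<in> Phi \<infinity>"
proof -
  have "concave_on {0..} \<phi>"
  proof
    fix t x y :: real
    assume t: "0 < t" "t < 1" and xy: "x \<in> {0..}" "y \<in> {0..}" "x < y"
    define z where "z = (1 - t) * x + t * y"
    have "z > 0" using t xy unfolding z_def by (auto intro!: add_nonneg_pos)
    have "(1 - t) * \<phi> x + t * \<phi> y \<le> (1 - t) * (\<phi> z + D z * (x - z)) + t * (\<phi> z + D z * (y - z))"
      using t xy \<open>z > 0\<close> by (intro add_mono mult_left_mono tangent) auto
    also have "\<dots> = \<phi> z + D z * ((1 - t) * x + t * y - z)" by (simp add: algebra_simps)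
    also have "\<dots> = \<phi> z" by (simp add: z_def)
    finally show "(1 - t) * \<phi> x + t * \<phi> y \<le> \<phi> ((1 - t) *\<^sub>R x + t *\<^sub>R y)"
      by (simp add: z_def)
  qed simp
  moreover have "0 \<le> \<phi> s" if "0 \<le> s" for s
  proof (cases "s = 0")
    case False
    then have "D s * s \<le> \<phi> s" using tangent[of s 0] assms(1) that by simp
    moreover have "0 \<le> D s * s" using pos[of s] False that by simp
    ultimately show ?thesis by linarith
  qed (simp add: assms(1))
  moreover have "\<phi> C1_differentiable_on {0<..}"
    unfolding C1_differentiable_on_def using der assms(4)
    by (auto simp: has_real_derivative_iff_has_vector_derivative)
  moreover have "0 < deriv \<phi> s" if "0 < s" for s
    using DERIV_imp_deriv[OF der[OF that]] pos[OF that] by simp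
  moreover have "{s::real. 0 \<le> s} = {0..}" "{s::real. 0 < s} = {0<..}" by auto
  ultimately show ?thesis
    using assms(1,2) by (simp add: Phi_def)
qed

lemma Phi_infinity_id: "(\<lambda>s. s) \<in> Phi \<infinity>"
  by (rule Phi_infinity_by_tangents[where D = "\<lambda>_. 1"]) (auto intro: continuous_intros)

lemma Phi_infinity_add:
  assumes "\<phi> \<in> Phi \<infinity>" "\<psi> \<in> Phi \<infinity>"
  shows "(\<lambda>s. \<phi> s + \<psi> s) \<in> Phi \<infinity>"
proof (rule Phi_infinity_by_tangents[where D = "\<lambda>s. deriv \<phi> s + deriv \<psi> s"])
  have "continuous (at 0 within {0..}) \<phi>" "continuous (at 0 within {0..}) \<psi>" "\<phi> 0 = 0" "\<psi> 0 = 0"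
    using assms by (auto simp: Phi_def atLeast_def)
  then show "\<phi> 0 + \<psi> 0 = 0" "continuous (at 0 within {0..}) (\<lambda>s. \<phi> s + \<psi> s)"
    by (auto intro: continuous_intros)
  show "continuous_on {0<..} (\<lambda>s. deriv \<phi> s + deriv \<psi> s)"
    using Phi_continuous_on_deriv[OF assms(1)] Phi_continuous_on_deriv[OF assms(2)]
    by (auto simp: greaterThan_def intro: continuous_intros)
next
  fix s t :: real assume "0 < t" "0 \<le> s"
  then show "\<phi> s + \<psi> s \<le> \<phi> t + \<psi> t + (deriv \<phi> t + deriv \<psi> t) * (s - t)"
    using Phi_below_tangent[OF assms(1), of t s] Phi_below_tangent[OF assms(2), of t s]
    by (simp add: algebra_simps)
next
  fix t :: real assume t: "0 < t"
  show "((\<lambda>s. \<phi> s + \<psi> s) has_real_derivative deriv \<phi> t + deriv \<psi> t) (at t)"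
    using t by (intro DERIV_add Phi_has_derivative[OF assms(1)] Phi_has_derivative[OF assms(2)]) simp_all
  show "0 < deriv \<phi> t + deriv \<psi> t"
    using t by (intro add_pos_pos Phi_deriv_pos[OF assms(1)] Phi_deriv_pos[OF assms(2)]) simp_all
qed

lemma deriv_add_Phi_infinity:
  assumes "\<phi> \<in> Phi \<infinity>" "\<psi> \<in> Phi \<infinity>" "0 < s"
  shows "deriv (\<lambda>s. \<phi> s + \<psi> s) s = deriv \<phi> s + deriv \<psi> s"
  using assms(3)
  by (intro DERIV_imp_deriv DERIV_add Phi_has_derivative[OF assms(1)] Phi_has_derivative[OF assms(2)])
    simp_all

text \<open>The KL inequality only tests a desingularizing function near \<open>0\<close>, so beyond a small
  \<open>\<delta>\<close> the function may be replaced by its tangent.  This moves all desingularizing functions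
  into the single class \<open>Phi \<infinity>\<close>, in which they can be added.\<close>

definition linear_extension :: "real \<Rightarrow> (real \<Rightarrow> real) \<Rightarrow> real \<Rightarrow> real" where
  "linear_extension \<delta> \<phi> s = (if s \<le> \<delta> then \<phi> s else \<phi> \<delta> + deriv \<phi> \<delta> * (s - \<delta>))"

lemma linear_extension_has_derivative:
  assumes \<phi>: "\<phi> \<in> Phi \<zeta>" and \<delta>: "ereal \<delta> < \<zeta>" and "0 < s"
  shows "(linear_extension \<delta> \<phi> has_real_derivative deriv \<phi> (min s \<delta>)) (at s)"
proof -
  consider "s < \<delta>" | "s = \<delta>" | "\<delta> < s" by linarith
  then show ?thesis
  proof cases
    case 1
    then have "eventually (\<lambda>y. linear_extension \<delta> \<phi> y = \<phi> y) (nhds s)"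
      by (auto simp: linear_extension_def intro!: eventually_nhds_in_open[of "{..<\<delta>}", THEN eventually_mono])
    moreover have "(\<phi> has_real_derivative deriv \<phi> s) (at s)"
      using 1 \<delta> \<open>0 < s\<close>
      by (intro Phi_has_derivative[OF \<phi>]) (auto intro: less_trans[of "ereal s" "ereal \<delta>"])
    ultimately show ?thesis using 1 by (simp add: DERIV_cong_ev)
  next
    case 3
    then have "eventually (\<lambda>y. linear_extension \<delta> \<phi> y = \<phi> \<delta> + deriv \<phi> \<delta> * (y - \<delta>)) (nhds s)"
      by (auto simp: linear_extension_def intro!: eventually_nhds_in_open[of "{\<delta><..}", THEN eventually_mono])
    moreover have "((\<lambda>y. \<phi> \<delta> + deriv \<phi> \<delta> * (y - \<delta>)) has_real_derivative deriv \<phi> \<delta>) (at s)"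
      by (auto intro!: derivative_eq_intros)
    ultimately show ?thesis using 3 by (simp add: DERIV_cong_ev)
  next
    case 2
    let ?q = "\<lambda>y. (linear_extension \<delta> \<phi> y - linear_extension \<delta> \<phi> \<delta>) / (y - \<delta>)"
    have "(\<phi> has_real_derivative deriv \<phi> \<delta>) (at \<delta> within {..<\<delta>})"
      using 2 \<open>0 < s\<close>
      by (simp add: has_field_derivative_at_within[OF Phi_has_derivative[OF \<phi> _ \<delta>]])
    then have "((\<lambda>y. (\<phi> y - \<phi> \<delta>) / (y - \<delta>)) \<longlongrightarrow> deriv \<phi> \<delta>) (at_left \<delta>)"
      by (simp add: has_field_derivative_iff)
    then have "(?q \<longlongrightarrow> deriv \<phi> \<delta>) (at_left \<delta>)"
      by (rule Lim_transform_eventually)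
        (auto simp: eventually_at_filter linear_extension_def)
    moreover have "(?q \<longlongrightarrow> deriv \<phi> \<delta>) (at_right \<delta>)"
      by (rule Lim_transform_eventually[OF tendsto_const])
        (auto simp: eventually_at_filter linear_extension_def)
    ultimately have "(?q \<longlongrightarrow> deriv \<phi> \<delta>) (at \<delta>)" by (rule filterlim_split_at)
    then show ?thesis using 2 by (simp add: has_field_derivative_iff)
  qed
qed

lemma linear_extension_in_Phi:
  assumes \<phi>: "\<phi> \<in> Phi \<zeta>" and \<delta>: "0 < \<delta>" "ereal \<delta> < \<zeta>"
  shows "linear_extension \<delta> \<phi> \<in> Phi \<infinity>"
proof (rule Phi_infinity_by_tangents[where D = "\<lambda>s. deriv \<phi> (min s \<delta>)"])
  have below: "ereal (min s \<delta>) < \<zeta>" for s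
    using \<delta> by (meson ereal_less_eq(3) min.cobounded2 order.strict_trans1)
  show "linear_extension \<delta> \<phi> 0 = 0"
    using \<phi> \<delta> by (simp add: linear_extension_def Phi_def)
  have "(\<phi> \<longlongrightarrow> \<phi> 0) (at 0 within {s. 0 \<le> s \<and> ereal s < \<zeta>})"
    using \<phi> unfolding Phi_def continuous_within by blast
  then have "(\<phi> \<longlongrightarrow> \<phi> 0) (at 0 within {0..<\<delta>})"
    by (rule tendsto_within_subset) (use \<delta> in \<open>auto intro: less_trans[of "ereal _" "ereal \<delta>"]\<close>)
  then have "(linear_extension \<delta> \<phi> \<longlongrightarrow> \<phi> 0) (at 0 within {0..<\<delta>})"
    by (rule Lim_transform_eventually) (auto simp: eventually_at_filter linear_extension_def)
  moreover have "at 0 within {0..<\<delta>} = at (0::real) within {0..}"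
    using \<delta> by (intro at_within_nhd[of _ "{..<\<delta>}"]) auto
  ultimately show "continuous (at 0 within {0..}) (linear_extension \<delta> \<phi>)"
    using \<delta> by (simp add: continuous_within linear_extension_def)
  show "(linear_extension \<delta> \<phi> has_real_derivative deriv \<phi> (min t \<delta>)) (at t)" if "0 < t" for t
    using linear_extension_has_derivative[OF \<phi> \<delta>(2) that] .
  show "continuous_on {0<..} (\<lambda>s. deriv \<phi> (min s \<delta>))"
    using \<delta> below by (intro continuous_on_compose2[OF Phi_continuous_on_deriv[OF \<phi>]])
      (auto intro!: continuous_intros)
  show "0 < deriv \<phi> (min t \<delta>)" if "0 < t" for t
    using that \<delta> below by (intro Phi_deriv_pos[OF \<phi>]) auto
  fix s t :: real assume t: "0 < t" and s: "0 \<le> s"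
  have 1: "\<phi> (min s \<delta>) \<le> \<phi> (min t \<delta>) + deriv \<phi> (min t \<delta>) * (min s \<delta> - min t \<delta>)"
    using s t \<delta> below by (intro Phi_below_tangent[OF \<phi>]) auto
  have 2: "deriv \<phi> \<delta> \<le> deriv \<phi> (min t \<delta>)"
    using t \<delta> by (intro Phi_deriv_antimono[OF \<phi>]) auto
  have 3: "deriv \<phi> \<delta> * (s - \<delta>) \<le> deriv \<phi> (min t \<delta>) * (s - \<delta>)" if "s > \<delta>"
    using 2 that by (intro mult_right_mono) auto
  show "linear_extension \<delta> \<phi> s \<le> linear_extension \<delta> \<phi> t + deriv \<phi> (min t \<delta>) * (s - t)"
  proof (cases "s \<le> \<delta>")
    case True
    then have "linear_extension \<delta> \<phi> s = \<phi> (min s \<delta>)" "min s \<delta> = s"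
      by (simp_all add: linear_extension_def)
    then show ?thesis
      using 1 by (cases "t \<le> \<delta>") (simp_all add: linear_extension_def right_diff_distrib)
  next
    case False
    then have "linear_extension \<delta> \<phi> s = \<phi> (min s \<delta>) + deriv \<phi> \<delta> * (s - \<delta>)" "min s \<delta> = \<delta>"
      by (simp_all add: linear_extension_def)
    then show ?thesis
      using 1 3 False by (cases "t \<le> \<delta>") (simp_all add: linear_extension_def right_diff_distrib)
  qed
qed

section \<open>A uniform KL inequality near finitely many levels\<close>

text \<open>Adding desingularizing functions only increases the derivative, so their sum works for
  all the inequalities at once.\<close>

lemma common_desingularizing_function:
  fixes n :: "'b \<Rightarrow> real"
  assumes "finite A" and n: "\<And>x. 0 \<le> n x"
    and "\<And>a. a \<in> A \<Longrightarrow> \<exists>\<phi>\<in>Phi \<infinity>. \<exists>\<eta>>0. \<forall>x. Q a x \<longrightarrow> 0 < r a x \<longrightarrow> r a x < \<eta> \<longrightarrow> 1 \<le> n x * deriv \<phi> (r a x)"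
  shows "\<exists>\<phi>\<in>Phi \<infinity>. \<exists>\<eta>>0. \<forall>a\<in>A. \<forall>x. Q a x \<longrightarrow> 0 < r a x \<longrightarrow> r a x < \<eta> \<longrightarrow> 1 \<le> n x * deriv \<phi> (r a x)"
  using assms(1,3)
proof (induction A rule: finite_induct)
  case empty
  then show ?case using Phi_infinity_id by (auto intro!: bexI exI[of _ 1])
next
  case (insert b A)
  obtain \<phi> \<eta> where \<phi>: "\<phi> \<in> Phi \<infinity>" "0 < \<eta>"
    "\<And>a x. a \<in> A \<Longrightarrow> Q a x \<Longrightarrow> 0 < r a x \<Longrightarrow> r a x < \<eta> \<Longrightarrow> 1 \<le> n x * deriv \<phi> (r a x)"
    using insert by (metis insertCI)
  obtain \<psi> \<theta> where \<psi>: "\<psi> \<in> Phi \<infinity>" "0 < \<theta>"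
    "\<And>x. Q b x \<Longrightarrow> 0 < r b x \<Longrightarrow> r b x < \<theta> \<Longrightarrow> 1 \<le> n x * deriv \<psi> (r b x)"
    using insert.prems by (metis insertI1)
  have "1 \<le> n x * deriv (\<lambda>s. \<phi> s + \<psi> s) (r a x)"
    if "a \<in> insert b A" "Q a x" "0 < r a x" "r a x < min \<eta> \<theta>" for a x
  proof -
    have nonneg: "0 \<le> n x * deriv \<phi> (r a x)" "0 \<le> n x * deriv \<psi> (r a x)"
      using n Phi_deriv_pos[OF \<phi>(1), of "r a x"] Phi_deriv_pos[OF \<psi>(1), of "r a x"] that
      by simp_all
    have "1 \<le> n x * deriv \<phi> (r a x) \<or> 1 \<le> n x * deriv \<psi> (r a x)"
      using that \<phi>(3)[of a x] \<psi>(3)[of x] by auto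
    then show ?thesis
      using nonneg that by (auto simp: deriv_add_Phi_infinity[OF \<phi>(1) \<psi>(1)] distrib_left)
  qed
  then show ?case
    using Phi_infinity_add[OF \<phi>(1) \<psi>(1)] \<phi>(2) \<psi>(2) by (intro bexI exI[of _ "min \<eta> \<theta>"]) auto
qed

lemma KL_at_Phi_infinity:
  assumes "KL_at V a"
  shows "\<exists>U. open U \<and> a \<in> U \<and> (\<exists>\<phi>\<in>Phi \<infinity>. \<exists>\<eta>>0. \<forall>x. x \<in> U \<longrightarrow> 0 < V x - V a \<longrightarrow> V x - V a < \<eta> \<longrightarrow>
           1 \<le> norm (grad V x) * deriv \<phi> (V x - V a))"
proof -
  obtain N \<zeta> \<phi> where N: "a \<in> interior N" and \<zeta>: "0 < \<zeta>" and \<phi>: "\<phi> \<in> Phi \<zeta>" and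
    KL: "\<And>x. x \<in> N \<Longrightarrow> 0 < V x - V a \<Longrightarrow> ereal (V x - V a) < \<zeta> \<Longrightarrow>
      1 \<le> norm (grad V x) * deriv \<phi> (V x - V a)"
    using assms unfolding KL_at_def by blast
  obtain \<delta> :: real where "0 < ereal \<delta>" and \<delta>: "ereal \<delta> < \<zeta>"
    using ereal_dense2[OF \<zeta>] by blast
  then have "0 < \<delta>" by simp
  have "1 \<le> norm (grad V x) * deriv (linear_extension \<delta> \<phi>) (V x - V a)"
    if "x \<in> interior N" "0 < V x - V a" "V x - V a < \<delta>" for x
  proof -
    have "deriv (linear_extension \<delta> \<phi>) (V x - V a) = deriv \<phi> (V x - V a)"
      using linear_extension_has_derivative[OF \<phi> \<delta> that(2)] that(3) by (simp add: DERIV_imp_deriv)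
    moreover have "ereal (V x - V a) < \<zeta>"
      using that \<delta> by (meson less_ereal.simps(1) order.strict_trans)
    ultimately show ?thesis using KL[of x] that interior_subset[of N] by auto
  qed
  then have "\<exists>\<phi>\<in>Phi \<infinity>. \<exists>\<eta>>0. \<forall>x. x \<in> interior N \<longrightarrow> 0 < V x - V a \<longrightarrow> V x - V a < \<eta> \<longrightarrow>
           1 \<le> norm (grad V x) * deriv \<phi> (V x - V a)"
    using linear_extension_in_Phi[OF \<phi> \<open>0 < \<delta>\<close> \<delta>] \<open>0 < \<delta>\<close> by blast
  then show ?thesis by (intro exI[of _ "interior N"] conjI open_interior N)
qed

lemma compact_sublevel_coercive:
  fixes V :: "'h::euclidean_space \<Rightarrow> real"
  assumes "coercive V" "continuous_on UNIV V"
  shows "compact {x. V x \<le> c}"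
proof -
  have "eventually (\<lambda>x. c + 1 \<le> V x) at_infinity"
    using assms(1) unfolding coercive_def filterlim_at_top by blast
  then obtain b where b: "\<And>x. b \<le> norm x \<Longrightarrow> c + 1 \<le> V x"
    by (auto simp: eventually_at_infinity)
  have "norm x \<le> b" if "V x \<le> c" for x
    using b[of x] that by linarith
  then have "bounded {x. V x \<le> c}" by (auto simp: bounded_iff)
  moreover have "closed {x. V x \<le> c}"
    by (intro closed_Collect_le continuous_on_const assms(2))
  ultimately show ?thesis by (simp add: compact_eq_bounded_closed)
qed

lemma bounded_below_coercive:
  fixes V :: "'h::euclidean_space \<Rightarrow> real"
  assumes "coercive V" "continuous_on UNIV V"
  shows "\<exists>c. \<forall>x. c \<le> V x"
proof -
  obtain y where y: "\<And>x. V x \<le> V 0 \<Longrightarrow> V y \<le> V x" and "V y \<le> V 0"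
    using continuous_attains_inf[OF compact_sublevel_coercive[OF assms, of "V 0"], of V]
      continuous_on_subset[OF assms(2)] by auto
  then show ?thesis by (intro exI[of _ "V y"] allI) (metis linear order_trans)
qed

text \<open>The level set is compact, so finitely many KL neighbourhoods cover it.  By compactness of
  a slightly larger sublevel set, every point whose value is above the level but close to it lies
  in one of them.  This is why closeness of the value alone suffices.\<close>

lemma uniform_KL_above_level:
  fixes V :: "'h::euclidean_space \<Rightarrow> real"
  assumes coer: "coercive V" and cont: "continuous_on UNIV V" and KL: "KL_on UNIV V"
  shows "\<exists>\<phi>\<in>Phi \<infinity>. \<exists>\<eta>>0. \<forall>x. 0 < V x - v \<longrightarrow> V x - v < \<eta> \<longrightarrow> 1 \<le> norm (grad V x) * deriv \<phi> (V x - v)"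
proof -
  define L where "L = {x. V x = v}"
  have closed_L: "closed L" unfolding L_def by (intro closed_Collect_eq continuous_on_const cont)
  have "L = {x. V x \<le> v} \<inter> L" by (auto simp: L_def)
  then have "compact L"
    using compact_Int_closed[OF compact_sublevel_coercive[OF coer cont, of v] closed_L] by simp
  have "\<exists>U. open U \<and> a \<in> U \<and> (\<exists>\<phi>\<in>Phi \<infinity>. \<exists>\<eta>>0. \<forall>x. x \<in> U \<longrightarrow> 0 < V x - V a \<longrightarrow> V x - V a < \<eta> \<longrightarrow>
           1 \<le> norm (grad V x) * deriv \<phi> (V x - V a))" for a
    using KL by (intro KL_at_Phi_infinity) (simp add: KL_on_def)
  then obtain U where U: "\<And>a. open (U a)" "\<And>a. a \<in> U a"
    "\<And>a. \<exists>\<phi>\<in>Phi \<infinity>. \<exists>\<eta>>0. \<forall>x. x \<in> U a \<longrightarrow> 0 < V x - V a \<longrightarrow> V x - V a < \<eta> \<longrightarrow>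
           1 \<le> norm (grad V x) * deriv \<phi> (V x - V a)"
    by metis
  obtain A where A: "A \<subseteq> L" "finite A" "L \<subseteq> (\<Union>a\<in>A. U a)"
    using compactE_image[OF \<open>compact L\<close>, of L U] U by blast
  have "\<exists>\<phi>\<in>Phi \<infinity>. \<exists>\<eta>>0. \<forall>a\<in>A. \<forall>x. x \<in> U a \<longrightarrow> 0 < V x - v \<longrightarrow> V x - v < \<eta> \<longrightarrow>
           1 \<le> norm (grad V x) * deriv \<phi> (V x - v)"
  proof (rule common_desingularizing_function[OF A(2)])
    fix a assume "a \<in> A"
    then have "V a = v" using A(1) by (auto simp: L_def)
    then show "\<exists>\<phi>\<in>Phi \<infinity>. \<exists>\<eta>>0. \<forall>x. x \<in> U a \<longrightarrow> 0 < V x - v \<longrightarrow> V x - v < \<eta> \<longrightarrow>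
           1 \<le> norm (grad V x) * deriv \<phi> (V x - v)"
      using U(3)[of a] by simp
  qed simp
  then obtain \<phi> \<eta> where \<phi>: "\<phi> \<in> Phi \<infinity>" "0 < \<eta>"
    "\<And>a x. a \<in> A \<Longrightarrow> x \<in> U a \<Longrightarrow> 0 < V x - v \<Longrightarrow> V x - v < \<eta> \<Longrightarrow> 1 \<le> norm (grad V x) * deriv \<phi> (V x - v)"
    by metis
  \<comment> \<open>The part of a neighbourhood of the level, from above, that the cover misses.\<close>
  define R where "R = {x. V x \<le> v + 1} \<inter> ({x. v \<le> V x} - (\<Union>a\<in>A. U a))"
  have "closed ({x. v \<le> V x} - (\<Union>a\<in>A. U a))"
    using U(1) by (intro closed_Diff closed_Collect_le continuous_on_const cont) auto
  then have "compact R"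
    unfolding R_def by (intro compact_Int_closed compact_sublevel_coercive coer cont)
  have "\<exists>m>v. \<forall>x\<in>R. m \<le> V x"
  proof (cases "R = {}")
    case False
    then obtain y where y: "y \<in> R" "\<And>x. x \<in> R \<Longrightarrow> V y \<le> V x"
      using continuous_attains_inf[OF \<open>compact R\<close> False, of V] continuous_on_subset[OF cont] by auto
    then have "y \<notin> L" "v \<le> V y" using A(3) by (auto simp: R_def)
    then show ?thesis using y by (intro exI[of _ "V y"]) (auto simp: L_def)
  qed (auto intro: exI[of _ "v + 1"])
  then obtain m where m: "m > v" "\<And>x. x \<in> R \<Longrightarrow> m \<le> V x" by auto
  have "1 \<le> norm (grad V x) * deriv \<phi> (V x - v)"
    if near: "0 < V x - v" "V x - v < min \<eta> (min 1 (m - v))" for x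
  proof -
    have "x \<notin> R" using m(2)[of x] near by auto
    then obtain a where "a \<in> A" "x \<in> U a"
      using near by (auto simp: R_def)
    then show ?thesis using \<phi>(3) near by simp
  qed
  then show ?thesis
    using \<phi>(1,2) m(1) by (intro bexI[of _ \<phi>] exI[of _ "min \<eta> (min 1 (m - v))"]) auto
qed

lemma uniform_KL_above_finite_levels:
  fixes V :: "'h::euclidean_space \<Rightarrow> real"
  assumes "coercive V" and "continuous_on UNIV V" and "KL_on UNIV V" and "finite S"
  shows "\<exists>\<phi>\<in>Phi \<infinity>. \<exists>\<eta>>0. \<forall>v\<in>S. \<forall>x. 0 < V x - v \<longrightarrow> V x - v < \<eta> \<longrightarrow>
           1 \<le> norm (grad V x) * deriv \<phi> (V x - v)"
proof -
  have "\<exists>\<phi>\<in>Phi \<infinity>. \<exists>\<eta>>0. \<forall>v\<in>S. \<forall>x. True \<longrightarrow> 0 < V x - v \<longrightarrow> V x - v < \<eta> \<longrightarrow>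
           1 \<le> norm (grad V x) * deriv \<phi> (V x - v)"
    by (rule common_desingularizing_function[OF \<open>finite S\<close>])
      (simp_all only: simp_thms norm_ge_zero uniform_KL_above_level[OF assms(1-3)])
  then show ?thesis by (simp only: simp_thms)
qed

section \<open>Convergence of nonnegative supermartingales\<close>

text \<open>The strategy behind the upcrossing inequality: buy one unit when the price \<open>y\<close> is below
  \<open>a\<close> and sell it when the price is above \<open>b\<close>.  Whether the unit is held at time \<open>k\<close> depends on
  the prices up to time \<open>k\<close> only.\<close>

primrec holding :: "real \<Rightarrow> real \<Rightarrow> (nat \<Rightarrow> real) \<Rightarrow> nat \<Rightarrow> bool" where
  "holding a b y 0 = False"
| "holding a b y (Suc k) = (if holding a b y k then y (Suc k) \<le> b else y (Suc k) < a)"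

primrec sales :: "real \<Rightarrow> real \<Rightarrow> (nat \<Rightarrow> real) \<Rightarrow> nat \<Rightarrow> nat" where
  "sales a b y 0 = 0"
| "sales a b y (Suc k) = sales a b y k + (if holding a b y k \<and> b < y (Suc k) then 1 else 0)"

text \<open>Booking each completed trade with profit \<open>b - a\<close>, and valuing the open one as if bought
  at \<open>a\<close>, never exceeds the true gain, because purchases are made below \<open>a\<close> and sales above
  \<open>b\<close>.\<close>

lemma sales_le_gain:
  "(b - a) * sales a b y n + (if holding a b y n then y n - a else 0)
     \<le> (\<Sum>k<n. of_bool (holding a b y k) * (y (Suc k) - y k))"
proof (induction n)
  case (Suc n)
  show ?case
  proof (cases "holding a b y n \<and> b < y (Suc n)")
    case True
    then show ?thesis using Suc True by (simp add: distrib_left)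
  next
    case False
    then show ?thesis using Suc False by (cases "holding a b y n") auto
  qed
qed simp

text \<open>Once the number of sales has reached its maximum, a unit that is held is never sold again,
  so after the next purchase the price never exceeds \<open>b\<close>.\<close>

lemma bounded_sales_imp_no_oscillation:
  assumes "a < b" and bound: "\<And>n. sales a b y n \<le> B"
  shows "eventually (\<lambda>k. a \<le> y k) sequentially \<or> eventually (\<lambda>k. y k \<le> b) sequentially"
proof (rule disjCI)
  assume osc: "\<not> eventually (\<lambda>k. y k \<le> b) sequentially"
  obtain N where N: "\<And>n. sales a b y n \<le> sales a b y N"
    using ex_has_greatest_nat[of "\<lambda>_. True" 0 "sales a b y" "Suc B"] bound
    by (auto simp: less_Suc_eq_le)
  have "mono (sales a b y)" by (rule mono_iff_le_Suc[THEN iffD2]) simp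
  have no_sale: "y (Suc k) \<le> b" if "N \<le> k" "holding a b y k" for k
  proof (rule ccontr)
    assume "\<not> y (Suc k) \<le> b"
    then have "sales a b y (Suc k) = Suc (sales a b y k)" using that by simp
    then show False
      using N[of "Suc k"] monoD[OF \<open>mono (sales a b y)\<close> \<open>N \<le> k\<close>] by simp
  qed
  have "a \<le> y (Suc k)" if "N \<le> k" for k
  proof (rule ccontr)
    assume "\<not> a \<le> y (Suc k)"
    then have start: "holding a b y (Suc k)" using \<open>a < b\<close> by simp
    have "holding a b y j" if "Suc k \<le> j" for j
      using that
    proof (induction j rule: dec_induct)
      case (step i)
      then show ?case using no_sale[of i] \<open>N \<le> k\<close> by simp
    qed (rule start)
    then have "y (Suc j) \<le> b" if "Suc k \<le> j" for j
      using no_sale[of j] that \<open>N \<le> k\<close> by simp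
    then have "eventually (\<lambda>j. y (Suc j) \<le> b) sequentially"
      by (auto simp: eventually_sequentially)
    then show False using osc by (simp add: eventually_sequentially_Suc[where P = "\<lambda>j. y j \<le> b"])
  qed
  then have "eventually (\<lambda>k. a \<le> y (Suc k)) sequentially"
    by (auto simp: eventually_sequentially)
  then show "eventually (\<lambda>k. a \<le> y k) sequentially"
    by (simp add: eventually_sequentially_Suc[where P = "\<lambda>j. a \<le> y j"])
qed

lemma convergent_if_no_oscillation:
  fixes y :: "nat \<Rightarrow> real"
  assumes nonneg: "\<And>k. 0 \<le> y k" and fin: "liminf (\<lambda>k. ennreal (y k)) < \<infinity>"
    and no_osc: "\<And>p q :: rat. 0 \<le> p \<Longrightarrow> p < q \<Longrightarrow>
      eventually (\<lambda>k. real_of_rat p \<le> y k) sequentially \<or> eventually (\<lambda>k. y k \<le> real_of_rat q) sequentially"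
  shows "y \<longlonglongrightarrow> enn2real (liminf (\<lambda>k. ennreal (y k)))"
proof -
  let ?y = "\<lambda>k. ennreal (y k)"
  have "limsup ?y \<le> liminf ?y"
  proof (rule ccontr)
    assume "\<not> limsup ?y \<le> liminf ?y"
    then have "liminf ?y < limsup ?y" by simp
    then obtain q where q: "liminf ?y < ennreal (real_of_rat q)" "ennreal (real_of_rat q) < limsup ?y"
      using ennreal_rat_dense by blast
    obtain p where p: "liminf ?y < ennreal (real_of_rat p)" "ennreal (real_of_rat p) < ennreal (real_of_rat q)"
      using ennreal_rat_dense[OF q(1)] by auto
    have "0 < real_of_rat p" using p(1) by (metis ennreal_neg linorder_not_le not_less_zero)
    then have pq: "0 \<le> p" "p < q"
      using p(2) by (simp_all add: ennreal_less_iff of_rat_less)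
    from no_osc[OF pq] show False
    proof
      assume "eventually (\<lambda>k. real_of_rat p \<le> y k) sequentially"
      then have "ennreal (real_of_rat p) \<le> liminf ?y"
        by (intro Liminf_bounded) (auto elim!: eventually_mono intro: ennreal_leI)
      with p(1) show False by simp
    next
      assume "eventually (\<lambda>k. y k \<le> real_of_rat q) sequentially"
      then have "limsup ?y \<le> ennreal (real_of_rat q)"
        by (intro Limsup_bounded) (auto elim!: eventually_mono intro: ennreal_leI)
      with q(2) show False by simp
    qed
  qed
  then have "limsup ?y = liminf ?y"
    using Liminf_le_Limsup[of sequentially ?y] by simp
  then have "?y \<longlonglongrightarrow> liminf ?y"
    by (simp add: tendsto_iff_Liminf_eq_Limsup)
  moreover have "liminf ?y = ennreal (enn2real (liminf ?y))" using fin by simp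
  ultimately show ?thesis
    using nonneg by (intro tendsto_ennrealD[of y]) (simp_all add: eventually_sequentially)
qed

lemma supermartingale_expectation_le:
  assumes "prob_space M" and sub: "\<And>k. subalgebra M (F k)" and super: "supermartingale M F X"
  shows "(\<integral>\<omega>. X k \<omega> \<partial>M) \<le> (\<integral>\<omega>. X 0 \<omega> \<partial>M)"
proof (induction k)
  case (Suc k)
  interpret prob_space M by fact
  interpret finite_measure_subalgebra M "F k"
    by unfold_locales (rule sub)
  have int: "integrable M (X j)" for j using super by (simp add: supermartingale_def)
  have "(\<integral>\<omega>. X (Suc k) \<omega> \<partial>M) = (\<integral>\<omega>. real_cond_exp M (F k) (X (Suc k)) \<omega> \<partial>M)"
    using real_cond_exp_int(2)[OF int] by simp
  also have "\<dots> \<le> (\<integral>\<omega>. X k \<omega> \<partial>M)"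
    using super by (intro integral_mono_AE real_cond_exp_int(1) int) (simp add: supermartingale_def)
  finally show ?case using Suc by simp
qed simp

lemma measurable_holding:
  assumes filt: "filtration (space M) F" and X: "\<And>k. X k \<in> borel_measurable (F k)"
  shows "Measurable.pred (F k) (\<lambda>\<omega>. holding a b (\<lambda>j. X j \<omega>) k)"
proof (induction k)
  case (Suc k)
  have "F k \<rightarrow>\<^sub>M count_space UNIV \<subseteq> F (Suc k) \<rightarrow>\<^sub>M count_space (UNIV :: bool set)"
    using filtration.sets_F_mono[OF filt, of k "Suc k"] filtration.space_F[OF filt]
    by (intro measurable_mono) auto
  then have [measurable]: "Measurable.pred (F (Suc k)) (\<lambda>\<omega>. holding a b (\<lambda>j. X j \<omega>) k)"
    using Suc by blast
  note X[of "Suc k", measurable]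
  show ?case by simp measurable
qed simp

text \<open>Trading a supermartingale by a strategy that does not look ahead has nonpositive expected
  gain.  Prices are nonnegative, so the loss on the open trade is at most \<open>a\<close>.\<close>

lemma expected_sales_le:
  assumes "prob_space M" and filt: "filtration (space M) F" and sub: "\<And>k. subalgebra M (F k)"
    and super: "supermartingale M F X" and nonneg: "\<And>k \<omega>. 0 \<le> X k \<omega>" and ab: "0 \<le> a" "a < b"
  shows "(\<integral>\<^sup>+\<omega>. ennreal (sales a b (\<lambda>k. X k \<omega>) n) \<partial>M) \<le> ennreal (a / (b - a))"
proof -
  interpret prob_space M by fact
  have adapted: "X k \<in> borel_measurable (F k)" and int: "integrable M (X k)" for k
    using super by (auto simp: supermartingale_def)
  define s where "s k \<omega> = (of_bool (holding a b (\<lambda>j. X j \<omega>) k) :: real)" for k \<omega>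
  note [measurable] = measurable_holding[OF filt, of X, OF adapted]
  have s_F [measurable]: "s k \<in> borel_measurable (F k)" for k
    unfolding s_def by measurable
  have s_M [measurable]: "s k \<in> borel_measurable M" for k
    using measurable_from_subalg[OF sub s_F] .
  have X_M [measurable]: "X k \<in> borel_measurable M" for k
    using int by auto
  have int_s: "integrable M (\<lambda>\<omega>. s k \<omega> * X j \<omega>)" for k j
  proof (rule Bochner_Integration.integrable_bound[OF int[of j]])
    show "AE \<omega> in M. norm (s k \<omega> * X j \<omega>) \<le> norm (X j \<omega>)" by (simp add: s_def)
  qed measurable
  have gain: "(\<integral>\<omega>. s k \<omega> * (X (Suc k) \<omega> - X k \<omega>) \<partial>M) \<le> 0" for k
  proof -
    interpret finite_measure_subalgebra M "F k"
      by unfold_locales (rule sub)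
    have le: "AE \<omega> in M. real_cond_exp M (F k) (X (Suc k)) \<omega> \<le> X k \<omega>"
      using super by (simp add: supermartingale_def)
    have "(\<integral>\<omega>. s k \<omega> * X (Suc k) \<omega> \<partial>M) = (\<integral>\<omega>. s k \<omega> * real_cond_exp M (F k) (X (Suc k)) \<omega> \<partial>M)"
      by (rule real_cond_exp_intg(2)[OF int_s s_F X_M, symmetric])
    also have "\<dots> \<le> (\<integral>\<omega>. s k \<omega> * X k \<omega> \<partial>M)"
      using le by (intro integral_mono_AE real_cond_exp_intg(1) int_s s_F X_M)
        (auto simp: s_def)
    finally show ?thesis by (simp add: right_diff_distrib int_s)
  qed
  define G where "G \<omega> = (\<Sum>k<n. s k \<omega> * (X (Suc k) \<omega> - X k \<omega>))" for \<omega>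
  have int_step: "integrable M (\<lambda>\<omega>. s k \<omega> * (X (Suc k) \<omega> - X k \<omega>))" for k
    by (simp add: right_diff_distrib int_s)
  have int_G: "integrable M G" unfolding G_def by (intro Bochner_Integration.integrable_sum int_step)
  have "(\<integral>\<omega>. G \<omega> \<partial>M) \<le> 0"
    unfolding G_def by (subst Bochner_Integration.integral_sum) (auto intro!: int_step sum_nonpos gain)
  have sales_le: "sales a b (\<lambda>k. X k \<omega>) n \<le> (G \<omega> + a) / (b - a)" for \<omega>
  proof -
    have "(b - a) * sales a b (\<lambda>k. X k \<omega>) n \<le> G \<omega> + a"
      using sales_le_gain[of b a "\<lambda>k. X k \<omega>" n] nonneg[of n \<omega>] ab
      by (auto simp: G_def s_def split: if_splits)
    then show ?thesis using ab by (simp add: pos_le_divide_eq mult.commute)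
  qed
  have "(\<integral>\<^sup>+\<omega>. ennreal (sales a b (\<lambda>k. X k \<omega>) n) \<partial>M) \<le> (\<integral>\<^sup>+\<omega>. ennreal ((G \<omega> + a) / (b - a)) \<partial>M)"
    by (intro nn_integral_mono ennreal_leI sales_le)
  also have "\<dots> = ennreal (\<integral>\<omega>. (G \<omega> + a) / (b - a) \<partial>M)"
    using int_G by (intro nn_integral_eq_integral AE_I2)
      (auto intro: order_trans[OF _ sales_le])
  also have "(\<integral>\<omega>. (G \<omega> + a) / (b - a) \<partial>M) = ((\<integral>\<omega>. G \<omega> \<partial>M) + a) / (b - a)"
    using int_G by (simp add: prob_space)
  also have "ennreal \<dots> \<le> ennreal (a / (b - a))"
    using \<open>(\<integral>\<omega>. G \<omega> \<partial>M) \<le> 0\<close> ab by (intro ennreal_leI divide_right_mono) auto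
  finally show ?thesis .
qed

lemma AE_bounded_sales:
  assumes "prob_space M" and filt: "filtration (space M) F" and sub: "\<And>k. subalgebra M (F k)"
    and super: "supermartingale M F X" and nonneg: "\<And>k \<omega>. 0 \<le> X k \<omega>" and ab: "0 \<le> a" "a < b"
  shows "AE \<omega> in M. \<exists>B. \<forall>n. sales a b (\<lambda>k. X k \<omega>) n \<le> B"
proof -
  let ?S = "\<lambda>n \<omega>. ennreal (sales a b (\<lambda>k. X k \<omega>) n)"
  have adapted: "X k \<in> borel_measurable (F k)" and "integrable M (X k)" for k
    using super by (auto simp: supermartingale_def)
  then have [measurable]: "X k \<in> borel_measurable M" for k by auto
  have "(\<lambda>\<omega>. holding a b (\<lambda>j. X j \<omega>) k) \<in> measurable M (count_space UNIV)" for k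
    using measurable_from_subalg[OF sub measurable_holding[OF filt, of X, OF adapted]] .
  note [measurable] = this
  have S [measurable]: "(\<lambda>\<omega>. sales a b (\<lambda>k. X k \<omega>) n) \<in> measurable M (count_space UNIV)" for n
    by (induction n) simp_all
  have "(\<integral>\<^sup>+\<omega>. (SUP n. ?S n \<omega>) \<partial>M) = (SUP n. \<integral>\<^sup>+\<omega>. ?S n \<omega> \<partial>M)"
  proof (rule nn_integral_monotone_convergence_SUP)
    show "incseq ?S"
      by (rule incseq_SucI) (auto simp: le_fun_def intro!: ennreal_leI)
  qed measurable
  also have "\<dots> \<le> ennreal (a / (b - a))"
    by (intro SUP_least expected_sales_le[OF assms])
  finally have "(\<integral>\<^sup>+\<omega>. (SUP n. ?S n \<omega>) \<partial>M) \<noteq> \<infinity>" by (auto simp: top_unique)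
  then have "AE \<omega> in M. (SUP n. ?S n \<omega>) \<noteq> \<infinity>"
    by (intro nn_integral_PInf_AE) measurable
  then show ?thesis
  proof (rule AE_mp, intro AE_I2 impI)
    fix \<omega> assume "(SUP n. ?S n \<omega>) \<noteq> \<infinity>"
    then obtain r where r: "(SUP n. ?S n \<omega>) = ennreal r" "0 \<le> r"
      by (cases "SUP n. ?S n \<omega>") auto
    have "sales a b (\<lambda>k. X k \<omega>) n \<le> nat \<lceil>r\<rceil>" for n
    proof -
      have "?S n \<omega> \<le> ennreal r" unfolding r(1)[symmetric] by (rule SUP_upper) simp
      then have "real (sales a b (\<lambda>k. X k \<omega>) n) \<le> r" using r(2) by simp
      then show ?thesis by linarith
    qed
    then show "\<exists>B. \<forall>n. sales a b (\<lambda>k. X k \<omega>) n \<le> B" by blast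
  qed
qed

theorem nonneg_supermartingale_converges:
  assumes "prob_space M" and filt: "filtration (space M) F" and sub: "\<And>k. subalgebra M (F k)"
    and super: "supermartingale M F X" and nonneg: "\<And>k \<omega>. 0 \<le> X k \<omega>"
  shows "\<exists>L. integrable M L \<and> (AE \<omega> in M. (\<lambda>k. X k \<omega>) \<longlonglongrightarrow> L \<omega>)"
proof -
  have int: "integrable M (X k)" for k
    using super by (auto simp: supermartingale_def)
  then have [measurable]: "X k \<in> borel_measurable M" for k by auto
  let ?l = "\<lambda>\<omega>. liminf (\<lambda>k. ennreal (X k \<omega>))"
  have "(\<integral>\<^sup>+\<omega>. ?l \<omega> \<partial>M) \<le> liminf (\<lambda>k. \<integral>\<^sup>+\<omega>. ennreal (X k \<omega>) \<partial>M)"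
    by (intro nn_integral_liminf) measurable
  also have "\<dots> \<le> liminf (\<lambda>k. ennreal (\<integral>\<omega>. X 0 \<omega> \<partial>M))"
    using supermartingale_expectation_le[OF assms(1) sub super] nonneg
    by (intro Liminf_mono always_eventually allI)
      (simp add: nn_integral_eq_integral[OF int] ennreal_leI)
  also have "\<dots> < \<infinity>" by (simp add: Liminf_const)
  finally have finite_integral: "(\<integral>\<^sup>+\<omega>. ?l \<omega> \<partial>M) < \<infinity>" .
  have "integrable M (\<lambda>\<omega>. enn2real (?l \<omega>))"
  proof (rule integrableI_nonneg)
    have "(\<integral>\<^sup>+\<omega>. ennreal (enn2real (?l \<omega>)) \<partial>M) \<le> (\<integral>\<^sup>+\<omega>. ?l \<omega> \<partial>M)"
      by (intro nn_integral_mono) (simp add: ennreal_enn2real_if)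
    then show "(\<integral>\<^sup>+\<omega>. ennreal (enn2real (?l \<omega>)) \<partial>M) < \<infinity>"
      using finite_integral by (rule le_less_trans)
  qed simp_all
  moreover have "AE \<omega> in M. (\<lambda>k. X k \<omega>) \<longlonglongrightarrow> enn2real (?l \<omega>)"
  proof -
    have "AE \<omega> in M. ?l \<omega> \<noteq> \<infinity>"
      using finite_integral by (intro nn_integral_PInf_AE) auto
    moreover have "AE \<omega> in M. \<forall>p q :: rat. 0 \<le> p \<longrightarrow> p < q \<longrightarrow>
        (\<exists>B. \<forall>n. sales (real_of_rat p) (real_of_rat q) (\<lambda>k. X k \<omega>) n \<le> B)"
      by (intro AE_all_countable[THEN iffD2] allI AE_impI AE_bounded_sales[OF assms])
        (simp_all add: of_rat_less)
    ultimately show ?thesis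
    proof eventually_elim
      case (elim \<omega>)
      show ?case
      proof (rule convergent_if_no_oscillation)
        show "?l \<omega> < \<infinity>" using elim(1) by (simp add: less_top)
        fix p q :: rat assume "0 \<le> p" "p < q"
        then show "eventually (\<lambda>k. real_of_rat p \<le> X k \<omega>) sequentially
            \<or> eventually (\<lambda>k. X k \<omega> \<le> real_of_rat q) sequentially"
          using elim(2) bounded_sales_imp_no_oscillation[of "real_of_rat p" "real_of_rat q"]
          by (meson of_rat_less)
      qed (rule nonneg)
    qed
  qed
  ultimately show ?thesis by blast
qed

lemma supermartingale_diff_const:
  assumes "prob_space M" and sub: "\<And>k. subalgebra M (F k)" and super: "supermartingale M F X"
  shows "supermartingale M F (\<lambda>k \<omega>. X k \<omega> - c)"
proof -
  interpret prob_space M by fact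
  have int: "integrable M (X k)" and [measurable]: "X k \<in> borel_measurable (F k)" for k
    using super by (auto simp: supermartingale_def)
  have "AE \<omega> in M. real_cond_exp M (F k) (\<lambda>\<omega>. X (Suc k) \<omega> - c) \<omega> \<le> X k \<omega> - c" for k
  proof -
    interpret finite_measure_subalgebra M "F k"
      by unfold_locales (rule sub)
    have "AE \<omega> in M. real_cond_exp M (F k) (X (Suc k)) \<omega> \<le> X k \<omega>"
      using super by (simp add: supermartingale_def)
    moreover have "AE \<omega> in M. real_cond_exp M (F k) (\<lambda>\<omega>. X (Suc k) \<omega> - c) \<omega>
        = real_cond_exp M (F k) (X (Suc k)) \<omega> - real_cond_exp M (F k) (\<lambda>_. c) \<omega>"
      by (intro real_cond_exp_diff int) simp
    moreover have "AE \<omega> in M. real_cond_exp M (F k) (\<lambda>_. c) \<omega> = c"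
      by (intro real_cond_exp_F_meas) simp_all
    ultimately show ?thesis by eventually_elim simp
  qed
  then show ?thesis using int by (simp add: supermartingale_def)
qed

theorem supermartingale_bounded_below_converges:
  assumes "prob_space M" and "filtration (space M) F" and "\<And>k. subalgebra M (F k)"
    and "supermartingale M F X" and "\<And>k \<omega>. c \<le> X k \<omega>"
  shows "\<exists>L. integrable M L \<and> (AE \<omega> in M. (\<lambda>k. X k \<omega>) \<longlonglongrightarrow> L \<omega>)"
proof -
  interpret prob_space M by fact
  obtain L where L: "integrable M L" "AE \<omega> in M. (\<lambda>k. X k \<omega> - c) \<longlonglongrightarrow> L \<omega>"
    using nonneg_supermartingale_converges[OF assms(1-3) supermartingale_diff_const[OF assms(1,3,4)], of c]
      assms(5) by auto
  have "AE \<omega> in M. (\<lambda>k. X k \<omega>) \<longlonglongrightarrow> L \<omega> + c"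
    using L(2)
  proof eventually_elim
    case (elim \<omega>)
    show ?case using tendsto_add[OF elim tendsto_const[of c]] by simp
  qed
  then show ?thesis using L(1) by (intro exI[of _ "\<lambda>\<omega>. L \<omega> + c"]) simp
qed

section \<open>Supermartingale decrements seen through a desingularizing function\<close>

lemma Phi_decrease:
  assumes \<phi>: "\<phi> \<in> Phi \<infinity>" and "0 < a" "0 \<le> b" "b \<le> a" and "0 < n" "1 \<le> n * deriv \<phi> a"
  shows "(a - b) / n \<le> \<phi> a - \<phi> b"
proof -
  have "(a - b) / n = (a - b) * (1 / n)" by simp
  also have "\<dots> \<le> (a - b) * deriv \<phi> a"
    using assms by (intro mult_left_mono) (simp_all add: pos_divide_le_eq mult.commute)
  also have "\<dots> \<le> \<phi> a - \<phi> b"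
    using Phi_below_tangent[OF \<phi>, of a b] assms by (simp add: algebra_simps)
  finally show ?thesis .
qed

text \<open>A member of \<open>Phi \<infinity>\<close> is arbitrary on the negative axis; composing it with \<open>max 0\<close>
  gives a continuous, hence Borel, function that agrees with it where it matters.\<close>

lemma Phi_infinity_continuous_on_max:
  assumes \<phi>: "\<phi> \<in> Phi \<infinity>"
  shows "continuous_on UNIV (\<lambda>s. \<phi> (max 0 s))"
proof -
  have "continuous (at s within {0..}) \<phi>" if "0 \<le> s" for s
  proof (cases "s = 0")
    case True
    then show ?thesis using \<phi> by (simp add: Phi_def atLeast_def)
  next
    case False
    then show ?thesis
      using DERIV_isCont[OF Phi_has_derivative[OF \<phi>, of s]] that
      by (auto intro: continuous_at_imp_continuous_at_within)
  qed
  then have "continuous_on {0..} \<phi>" by (simp add: continuous_on_eq_continuous_within)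
  then show ?thesis by (rule continuous_on_compose2) (auto intro!: continuous_intros)
qed

lemma Phi_infinity_nonneg: "\<phi> \<in> Phi \<infinity> \<Longrightarrow> 0 \<le> s \<Longrightarrow> 0 \<le> \<phi> s"
  by (simp add: Phi_def)

text \<open>Concave functions grow at most linearly.\<close>

lemma integrable_Phi_infinity:
  assumes "prob_space M" and \<phi>: "\<phi> \<in> Phi \<infinity>" and Y: "integrable M Y"
  shows "integrable M (\<lambda>\<omega>. \<phi> (max 0 (Y \<omega>)))"
proof -
  interpret prob_space M by fact
  have [measurable]: "(\<lambda>s. \<phi> (max 0 s)) \<in> borel_measurable borel"
    by (rule borel_measurable_continuous_onI[OF Phi_infinity_continuous_on_max[OF \<phi>]])
  have pos: "0 < deriv \<phi> 1" by (simp add: Phi_deriv_pos[OF \<phi>])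
  have bound: "\<phi> (max 0 s) \<le> \<phi> 1 + deriv \<phi> 1 * \<bar>s\<bar>" for s
  proof -
    have "\<phi> (max 0 s) \<le> \<phi> 1 + deriv \<phi> 1 * (max 0 s - 1)"
      by (intro Phi_below_tangent[OF \<phi>]) (simp_all add: max_def)
    also have "\<dots> \<le> \<phi> 1 + deriv \<phi> 1 * \<bar>s\<bar>"
      using pos by (intro add_left_mono mult_left_mono) auto
    finally show ?thesis .
  qed
  show ?thesis
  proof (rule Bochner_Integration.integrable_bound)
    show "integrable M (\<lambda>\<omega>. \<phi> 1 + deriv \<phi> 1 * \<bar>Y \<omega>\<bar>)" using Y by simp
    show "(\<lambda>\<omega>. \<phi> (max 0 (Y \<omega>))) \<in> borel_measurable M" using Y by measurable
    show "AE \<omega> in M. norm (\<phi> (max 0 (Y \<omega>))) \<le> norm (\<phi> 1 + deriv \<phi> 1 * \<bar>Y \<omega>\<bar>)"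
      using bound Phi_infinity_nonneg[OF \<phi>] by (auto intro: order_trans[OF _ abs_ge_self])
  qed
qed

lemma real_cond_exp_Phi_infinity_le:
  assumes "prob_space M" and sub: "subalgebra M G" and \<phi>: "\<phi> \<in> Phi \<infinity>"
    and Y: "integrable M Y" and pos: "AE \<omega> in M. 0 < Y \<omega>"
  shows "AE \<omega> in M. 0 < real_cond_exp M G Y \<omega>"
    and "AE \<omega> in M. real_cond_exp M G (\<lambda>\<omega>. \<phi> (max 0 (Y \<omega>))) \<omega> \<le> \<phi> (real_cond_exp M G Y \<omega>)"
proof -
  interpret prob_space M by fact
  interpret finite_measure_subalgebra M G
    by unfold_locales (rule sub)
  let ?q = "\<lambda>s. (-1) * \<phi> (max 0 s)"
  have "convex_on {0<..} ?q"
  proof -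
    have "convex_on {0<..} (\<lambda>s. - \<phi> s)"
      using \<phi> by (auto simp: Phi_def concave_on_def intro: convex_on_subset)
    moreover have "?q s = - \<phi> s" if "s \<in> {0<..}" for s using that by simp
    ultimately show ?thesis unfolding convex_on_def by (metis convexD)
  qed
  moreover have int: "integrable M (\<lambda>\<omega>. \<phi> (max 0 (Y \<omega>)))"
    by (rule integrable_Phi_infinity[OF assms(1) \<phi> Y])
  moreover have "?q \<in> borel_measurable borel"
    using borel_measurable_continuous_onI[OF Phi_infinity_continuous_on_max[OF \<phi>]] by simp
  ultimately have J: "AE \<omega> in M. real_cond_exp M G Y \<omega> \<in> {0<..}"
    "AE \<omega> in M. ?q (real_cond_exp M G Y \<omega>) \<le> real_cond_exp M G (\<lambda>\<omega>. ?q (Y \<omega>)) \<omega>"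
    using pos Y
      real_cond_exp_jensens_inequality[where X = Y and q = ?q and I = "{0<..}" and a = 0 and b = 0]
    by simp_all
  then show "AE \<omega> in M. 0 < real_cond_exp M G Y \<omega>" by simp
  have "AE \<omega> in M. real_cond_exp M G (\<lambda>\<omega>. ?q (Y \<omega>)) \<omega> = (-1) * real_cond_exp M G (\<lambda>\<omega>. \<phi> (max 0 (Y \<omega>))) \<omega>"
    by (rule real_cond_exp_cmult[OF int])
  with J show "AE \<omega> in M. real_cond_exp M G (\<lambda>\<omega>. \<phi> (max 0 (Y \<omega>))) \<omega> \<le> \<phi> (real_cond_exp M G Y \<omega>)"
    by eventually_elim simp
qed

text \<open>A random variable and its conditional expectation have the same mean, so an almost sure
  inequality between them is an equality.\<close>

lemma real_cond_exp_eq_if_ge: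
  assumes "prob_space M" and sub: "subalgebra M G" and Z: "integrable M Z"
    and ge: "AE \<omega> in M. Z \<omega> \<le> real_cond_exp M G Z \<omega>"
  shows "AE \<omega> in M. real_cond_exp M G Z \<omega> = Z \<omega>"
proof -
  interpret prob_space M by fact
  interpret finite_measure_subalgebra M G
    by unfold_locales (rule sub)
  let ?d = "\<lambda>\<omega>. real_cond_exp M G Z \<omega> - Z \<omega>"
  have int: "integrable M ?d" using real_cond_exp_int(1)[OF Z] Z by simp
  have "(\<integral>\<omega>. ?d \<omega> \<partial>M) = 0"
    using real_cond_exp_int[OF Z] Z by simp
  moreover have "AE \<omega> in M. 0 \<le> ?d \<omega>" using ge by simp
  ultimately have "AE \<omega> in M. ?d \<omega> = 0"
    using integral_nonneg_eq_0_iff_AE[OF int] by simp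
  then show ?thesis by simp
qed

text \<open>Expected decrements telescope, and nonnegativity bounds the total by the initial mean.\<close>

lemma nn_integral_sum_decrements_le:
  assumes "prob_space M" and sub: "\<And>k. subalgebra M (F k)"
    and int: "\<And>k. integrable M (U k)" and nonneg: "\<And>k \<omega>. 0 \<le> U k \<omega>"
    and le: "\<And>k. AE \<omega> in M. real_cond_exp M (F k) (U (Suc k)) \<omega> \<le> U k \<omega>"
  shows "(\<integral>\<^sup>+\<omega>. (\<Sum>k. ennreal (U k \<omega> - real_cond_exp M (F k) (U (Suc k)) \<omega>)) \<partial>M) \<le> (\<integral>\<^sup>+\<omega>. ennreal (U 0 \<omega>) \<partial>M)"
proof -
  interpret prob_space M by fact
  define d where "d k \<omega> = U k \<omega> - real_cond_exp M (F k) (U (Suc k)) \<omega>" for k \<omega>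
  have d_int: "integrable M (d k)" and d_integral: "(\<integral>\<omega>. d k \<omega> \<partial>M) = (\<integral>\<omega>. U k \<omega> \<partial>M) - (\<integral>\<omega>. U (Suc k) \<omega> \<partial>M)"
    for k
  proof -
    interpret finite_measure_subalgebra M "F k"
      by unfold_locales (rule sub)
    show "integrable M (d k)" "(\<integral>\<omega>. d k \<omega> \<partial>M) = (\<integral>\<omega>. U k \<omega> \<partial>M) - (\<integral>\<omega>. U (Suc k) \<omega> \<partial>M)"
      unfolding d_def using real_cond_exp_int[OF int[of "Suc k"]] int by simp_all
  qed
  have d_nonneg: "AE \<omega> in M. 0 \<le> d k \<omega>" for k using le[of k] by (simp add: d_def)
  have "(\<integral>\<^sup>+\<omega>. (\<Sum>k. ennreal (d k \<omega>)) \<partial>M) = (\<Sum>k. \<integral>\<^sup>+\<omega>. ennreal (d k \<omega>) \<partial>M)"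
    using d_int by (intro nn_integral_suminf) auto
  also have "\<dots> = (\<Sum>k. ennreal (\<integral>\<omega>. d k \<omega> \<partial>M))"
    by (simp add: nn_integral_eq_integral[OF d_int d_nonneg])
  also have "\<dots> = (SUP n. \<Sum>k<n. ennreal (\<integral>\<omega>. d k \<omega> \<partial>M))" by (rule suminf_eq_SUP)
  also have "\<dots> \<le> ennreal (\<integral>\<omega>. U 0 \<omega> \<partial>M)"
  proof (rule SUP_least)
    fix n :: nat
    have "(\<Sum>k<n. ennreal (\<integral>\<omega>. d k \<omega> \<partial>M)) = ennreal (\<Sum>k<n. \<integral>\<omega>. d k \<omega> \<partial>M)"
      by (intro sum_ennreal integral_nonneg_AE d_nonneg)
    also have "(\<Sum>k<n. \<integral>\<omega>. d k \<omega> \<partial>M) = (\<integral>\<omega>. U 0 \<omega> \<partial>M) - (\<integral>\<omega>. U n \<omega> \<partial>M)"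
      unfolding d_integral by (rule sum_lessThan_telescope')
    also have "\<dots> \<le> (\<integral>\<omega>. U 0 \<omega> \<partial>M)" using nonneg by (simp add: integral_nonneg_AE)
    finally show "(\<Sum>k<n. ennreal (\<integral>\<omega>. d k \<omega> \<partial>M)) \<le> ennreal (\<integral>\<omega>. U 0 \<omega> \<partial>M)"
      by (simp add: ennreal_leI)
  qed
  also have "\<dots> = (\<integral>\<^sup>+\<omega>. ennreal (U 0 \<omega>) \<partial>M)"
    using nonneg by (simp add: nn_integral_eq_integral[OF int])
  finally show ?thesis by (simp add: d_def)
qed

lemma limit_eq_at_accumulation_point:
  assumes "continuous_on UNIV V" and "y \<in> accumulation_points s" and "(\<lambda>k. V (s k)) \<longlonglongrightarrow> (v :: real)"
  shows "v = V y"
proof -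
  obtain r where r: "strict_mono r" "(s \<circ> r) \<longlonglongrightarrow> y"
    using assms(2) by (auto simp: accumulation_points_def)
  have "(\<lambda>k. V ((s \<circ> r) k)) \<longlonglongrightarrow> V y"
    by (rule continuous_on_tendsto_compose[OF assms(1) r(2)]) simp_all
  moreover have "(\<lambda>k. V ((s \<circ> r) k)) \<longlonglongrightarrow> v"
    using LIMSEQ_subseq_LIMSEQ[OF assms(3) r(1)] by (simp add: comp_def)
  ultimately show ?thesis by (rule LIMSEQ_unique[symmetric])
qed

lemma drift_ratio_nonneg:
  assumes "supermartingale M F (\<lambda>k \<omega>. V (x k \<omega>))"
  shows "AE \<omega> in M. 0 \<le> drift_ratio M F V x k \<omega>"
proof -
  have "AE \<omega> in M. real_cond_exp M (F k) (\<lambda>\<omega>. V (x (Suc k) \<omega>)) \<omega> \<le> V (x k \<omega>)"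
    using assms by (simp add: supermartingale_def)
  then show ?thesis by eventually_elim (simp add: drift_ratio_def)
qed

text \<open>Write \<open>Y k = V (x k) - Z\<close>.  Since \<open>Z\<close> is fixed by conditioning, the decrement of
  \<open>V (x k)\<close> equals \<open>Y k - E[Y (k+1) | F k]\<close>.  Concavity of \<open>\<phi>\<close> together with the KL
  inequality at \<open>x k\<close> turns its quotient by the gradient norm into a decrement of \<open>\<phi>\<close>, and
  Jensen's inequality moves \<open>\<phi>\<close> inside the conditional expectation.\<close>

lemma drift_ratio_le_Phi_decrement:
  assumes "prob_space M" and sub: "\<And>k. subalgebra M (F k)"
    and super: "supermartingale M F (\<lambda>k \<omega>. V (x k \<omega>))"
    and Z: "integrable M Z" and Z_fixed: "AE \<omega> in M. real_cond_exp M (F k) Z \<omega> = Z \<omega>"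
    and above: "\<And>j. AE \<omega> in M. Z \<omega> < V (x j \<omega>)"
    and grad: "AE \<omega> in M. 0 < norm (grad V (x k \<omega>))"
    and \<phi>: "\<phi> \<in> Phi \<infinity>"
  defines "Y \<equiv> \<lambda>j \<omega>. V (x j \<omega>) - Z \<omega>"
  defines "d \<equiv> \<lambda>\<omega>. \<phi> (max 0 (Y k \<omega>)) - real_cond_exp M (F k) (\<lambda>\<omega>. \<phi> (max 0 (Y (Suc k) \<omega>))) \<omega>"
  shows "AE \<omega> in M. 0 \<le> d \<omega>"
    and "AE \<omega> in M. 1 \<le> norm (grad V (x k \<omega>)) * deriv \<phi> (Y k \<omega>) \<longrightarrow> drift_ratio M F V x k \<omega> \<le> d \<omega>"
proof -
  interpret prob_space M by fact
  interpret finite_measure_subalgebra M "F k"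
    by unfold_locales (rule sub)
  let ?E = "\<lambda>\<omega>. real_cond_exp M (F k) (\<lambda>\<omega>. V (x (Suc k) \<omega>)) \<omega>"
  let ?b = "real_cond_exp M (F k) (Y (Suc k))"
  have int: "integrable M (\<lambda>\<omega>. V (x j \<omega>))" for j
    using super by (simp add: supermartingale_def)
  have Y_int: "integrable M (Y j)" for j unfolding Y_def using int Z by simp
  have Y_pos: "AE \<omega> in M. 0 < Y j \<omega>" for j using above[of j] by (simp add: Y_def)
  have "AE \<omega> in M. ?b \<omega> = ?E \<omega> - real_cond_exp M (F k) Z \<omega>"
    unfolding Y_def by (intro real_cond_exp_diff int Z)
  with Z_fixed have b: "AE \<omega> in M. ?b \<omega> = ?E \<omega> - Z \<omega>" by eventually_elim simp
  have dec: "AE \<omega> in M. ?E \<omega> \<le> V (x k \<omega>)" using super by (simp add: supermartingale_def)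
  note J = real_cond_exp_Phi_infinity_le[OF assms(1) sub \<phi> Y_int Y_pos, of k "Suc k"]
  show "AE \<omega> in M. 0 \<le> d \<omega>"
    using b dec J Y_pos[of k]
  proof eventually_elim
    case (elim \<omega>)
    have "\<phi> (?b \<omega>) \<le> \<phi> (Y k \<omega>)"
      using elim by (intro Phi_mono[OF \<phi>]) (simp_all add: Y_def)
    then show ?case using elim by (simp add: d_def)
  qed
  show "AE \<omega> in M. 1 \<le> norm (grad V (x k \<omega>)) * deriv \<phi> (Y k \<omega>) \<longrightarrow> drift_ratio M F V x k \<omega> \<le> d \<omega>"
    using b dec J Y_pos[of k] grad
  proof eventually_elim
    case (elim \<omega>)
    show ?case
    proof
      assume KL: "1 \<le> norm (grad V (x k \<omega>)) * deriv \<phi> (Y k \<omega>)"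
      have "drift_ratio M F V x k \<omega> = (Y k \<omega> - ?b \<omega>) / norm (grad V (x k \<omega>))"
        using elim(1) by (simp add: drift_ratio_def Y_def)
      also have "\<dots> \<le> \<phi> (Y k \<omega>) - \<phi> (?b \<omega>)"
        using elim KL by (intro Phi_decrease[OF \<phi>]) (simp_all add: Y_def)
      also have "\<dots> \<le> d \<omega>" using elim by (simp add: d_def)
      finally show "drift_ratio M F V x k \<omega> \<le> d \<omega>" .
    qed
  qed
qed

section \<open>The sum of drift ratios\<close>

text \<open>The time \<open>K\<close> looks into the future, which is harmless: the comparison with the
  decrements of \<open>\<phi>\<close> holds term by term once the values have come within \<open>\<eta>\<close> of their limit,
  and the decrements that are added to complete the sum are nonnegative.  The shift by one makes
  \<open>K\<close> positive.\<close>

lemma tail_sum_drift_ratio_le: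
  assumes "prob_space M" and sub: "\<And>k. subalgebra M (F k)"
    and super: "supermartingale M F (\<lambda>k \<omega>. V (x k \<omega>))"
    and Z: "integrable M Z" and lim: "AE \<omega> in M. (\<lambda>k. V (x k \<omega>)) \<longlonglongrightarrow> Z \<omega>"
    and Z_fixed: "\<And>k. AE \<omega> in M. real_cond_exp M (F k) Z \<omega> = Z \<omega>"
    and above: "\<And>k. AE \<omega> in M. Z \<omega> < V (x k \<omega>)"
    and grad: "\<And>k. AE \<omega> in M. 0 < norm (grad V (x k \<omega>))"
    and \<phi>: "\<phi> \<in> Phi \<infinity>" and "0 < \<eta>"
    and KL: "\<And>k. AE \<omega> in M. V (x k \<omega>) - Z \<omega> < \<eta> \<longrightarrow> 1 \<le> norm (grad V (x k \<omega>)) * deriv \<phi> (V (x k \<omega>) - Z \<omega>)"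
  shows "(\<exists>K :: 'a \<Rightarrow> enat. K \<in> measurable M (count_space UNIV) \<and> (\<forall>\<omega>\<in>space M. 0 < K \<omega>) \<and>
            (AE \<omega> in M. K \<omega> < \<infinity>) \<and>
            (\<integral>\<^sup>+\<omega>. tail_sum M F V x K \<omega> \<partial>M) \<le> (\<integral>\<^sup>+\<omega>. ennreal (\<phi> (V (x 0 \<omega>) - Z \<omega>)) \<partial>M)) \<and>
         (AE \<omega> in M. summable (\<lambda>k. drift_ratio M F V x k \<omega>))"
proof -
  interpret prob_space M by fact
  define Y where "Y k \<omega> = V (x k \<omega>) - Z \<omega>" for k \<omega>
  define U where "U k \<omega> = \<phi> (max 0 (Y k \<omega>))" for k \<omega>
  define d where "d k \<omega> = U k \<omega> - real_cond_exp M (F k) (U (Suc k)) \<omega>" for k \<omega>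
  define N where "N \<omega> = (LEAST n. \<forall>k\<ge>n. Y k \<omega> < \<eta>)" for \<omega>
  define K where "K \<omega> = enat (Suc (N \<omega>))" for \<omega>
  have Y_int: "integrable M (Y k)" for k
    unfolding Y_def using super Z by (simp add: supermartingale_def)
  then have [measurable]: "Y k \<in> borel_measurable M" for k by auto
  have U_int: "integrable M (U k)" for k
    unfolding U_def by (rule integrable_Phi_infinity[OF assms(1) \<phi> Y_int])
  have U_nonneg: "0 \<le> U k \<omega>" for k \<omega>
    unfolding U_def by (intro Phi_infinity_nonneg[OF \<phi>]) simp
  note compare = drift_ratio_le_Phi_decrement[OF assms(1) sub super Z Z_fixed above grad \<phi>,
      folded Y_def, folded U_def, folded d_def]
  have sum_d: "(\<integral>\<^sup>+\<omega>. (\<Sum>k. ennreal (d k \<omega>)) \<partial>M) \<le> (\<integral>\<^sup>+\<omega>. ennreal (U 0 \<omega>) \<partial>M)"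
    unfolding d_def
    using compare(1) by (intro nn_integral_sum_decrements_le assms(1) sub U_int U_nonneg) (simp add: d_def)

  have close: "AE \<omega> in M. \<forall>k. K \<omega> < enat k \<longrightarrow> drift_ratio M F V x k \<omega> \<le> d k \<omega>"
  proof -
    have "AE \<omega> in M. \<forall>k. Y k \<omega> < \<eta> \<longrightarrow> 1 \<le> norm (grad V (x k \<omega>)) * deriv \<phi> (Y k \<omega>)"
      using KL by (simp add: AE_all_countable Y_def)
    moreover have "AE \<omega> in M. \<forall>k. 1 \<le> norm (grad V (x k \<omega>)) * deriv \<phi> (Y k \<omega>) \<longrightarrow> drift_ratio M F V x k \<omega> \<le> d k \<omega>"
      using compare(2) by (simp add: AE_all_countable)
    ultimately show ?thesis using lim
    proof eventually_elim
      case (elim \<omega>)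
      have "(\<lambda>k. Y k \<omega>) \<longlonglongrightarrow> 0"
        using tendsto_diff[OF elim(3) tendsto_const[of "Z \<omega>"]] by (simp add: Y_def)
      then have "eventually (\<lambda>k. Y k \<omega> < \<eta>) sequentially"
        using \<open>0 < \<eta>\<close> by (rule order_tendstoD)
      then have "\<exists>n. \<forall>k\<ge>n. Y k \<omega> < \<eta>" by (simp add: eventually_sequentially)
      then have "\<forall>k\<ge>N \<omega>. Y k \<omega> < \<eta>" unfolding N_def by (rule LeastI_ex)
      then show ?case using elim(1,2) by (simp add: K_def)
    qed
  qed
  have tail_le: "AE \<omega> in M. tail_sum M F V x K \<omega> \<le> (\<Sum>k. ennreal (d k \<omega>))"
    using close
  proof eventually_elim
    case (elim \<omega>)
    then show ?case
      unfolding tail_sum_def by (intro suminf_le) (auto intro: ennreal_leI)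
  qed

  have "K \<in> measurable M (count_space UNIV)"
    unfolding K_def N_def by measurable
  moreover have "(\<integral>\<^sup>+\<omega>. tail_sum M F V x K \<omega> \<partial>M) \<le> (\<integral>\<^sup>+\<omega>. ennreal (\<phi> (V (x 0 \<omega>) - Z \<omega>)) \<partial>M)"
  proof -
    have "(\<integral>\<^sup>+\<omega>. tail_sum M F V x K \<omega> \<partial>M) \<le> (\<integral>\<^sup>+\<omega>. ennreal (U 0 \<omega>) \<partial>M)"
      using nn_integral_mono_AE[OF tail_le] sum_d by (rule order_trans)
    also have "\<dots> = (\<integral>\<^sup>+\<omega>. ennreal (\<phi> (V (x 0 \<omega>) - Z \<omega>)) \<partial>M)"
    proof (rule nn_integral_cong_AE)
      show "AE \<omega> in M. ennreal (U 0 \<omega>) = ennreal (\<phi> (V (x 0 \<omega>) - Z \<omega>))"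
        using above[of 0] by eventually_elim (simp add: U_def Y_def max_def)
    qed
    finally show ?thesis .
  qed
  moreover have "AE \<omega> in M. summable (\<lambda>k. drift_ratio M F V x k \<omega>)"
  proof -
    have "(\<integral>\<^sup>+\<omega>. ennreal (U 0 \<omega>) \<partial>M) < \<infinity>"
      using U_nonneg by (simp add: nn_integral_eq_integral[OF U_int])
    with sum_d have "(\<integral>\<^sup>+\<omega>. (\<Sum>k. ennreal (d k \<omega>)) \<partial>M) \<noteq> \<infinity>" by auto
    moreover have "d k \<in> borel_measurable M" for k
      unfolding d_def using U_int[of k] by (auto intro: borel_measurable_diff)
    ultimately have "AE \<omega> in M. (\<Sum>k. ennreal (d k \<omega>)) \<noteq> \<infinity>"
      by (intro nn_integral_PInf_AE) measurable
    moreover have "AE \<omega> in M. \<forall>k. 0 \<le> d k \<omega>"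
      using compare(1) by (simp add: AE_all_countable)
    moreover have "AE \<omega> in M. \<forall>k. 0 \<le> drift_ratio M F V x k \<omega>"
      using drift_ratio_nonneg[where V = V and x = x, OF super] by (simp add: AE_all_countable)
    ultimately show ?thesis using close
    proof eventually_elim
      case (elim \<omega>)
      have "summable (\<lambda>k. d k \<omega>)"
        using elim(1,2) by (intro summable_suminf_not_top) auto
      then show ?case
      proof (rule summable_comparison_test')
        show "norm (drift_ratio M F V x k \<omega>) \<le> d k \<omega>" if "k \<ge> Suc (Suc (N \<omega>))" for k
          using elim(3,4) that by (simp add: K_def)
      qed
    qed
  qed
  ultimately show ?thesis
    by (intro conjI exI[of _ K]) (simp_all add: K_def zero_enat_def)
qed

theorem theorem4p3:
  fixes M :: "'a measure"
    and F :: "nat \<Rightarrow> 'a measure"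
    and x :: "nat \<Rightarrow> 'a \<Rightarrow> 'h::euclidean_space"
    and V :: "'h \<Rightarrow> real"
    and \<Gamma> :: "'h set"
  assumes "prob_space M"
    and "filtration (space M) F"
    and "\<And>k. subalgebra M (F k)"
    and "\<And>k. x k \<in> borel_measurable M"
    and "coercive V"
    and "continuously_differentiable V"
    and "\<Gamma> \<noteq> {}"
    and "finite (V ` \<Gamma>)"
    and "AE \<omega> in M. \<Gamma> \<inter> accumulation_points (\<lambda>k. x k \<omega>) \<noteq> {}"
    and "KL_on UNIV V"
    and "\<exists>(I::nat) C. 1 \<le> I \<and> \<Gamma> = (\<Union>i\<in>{1..I}. C i) \<and>
           (\<forall>i\<in>{1..I}. compact (C i) \<and> V constant_on (C i))"
    and "supermartingale M F (\<lambda>k \<omega>. V (x k \<omega>))"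
  shows
    "(\<exists>Vinf. integrable M Vinf \<and> (AE \<omega> in M. (\<lambda>k. V (x k \<omega>)) \<longlonglongrightarrow> Vinf \<omega>)) \<and>
     (\<forall>Vinf. integrable M Vinf \<longrightarrow>
        (AE \<omega> in M. (\<lambda>k. V (x k \<omega>)) \<longlonglongrightarrow> Vinf \<omega>) \<longrightarrow>
        (\<forall>k. AE \<omega> in M. 0 < norm (grad V (x k \<omega>))) \<longrightarrow>
        (\<forall>k. (AE \<omega> in M. V (x k \<omega>) \<ge> real_cond_exp M (F k) Vinf \<omega> \<and>
                           real_cond_exp M (F k) Vinf \<omega> > Vinf \<omega>) \<or>
             (AE \<omega> in M. V (x k \<omega>) > real_cond_exp M (F k) Vinf \<omega> \<and>
                           real_cond_exp M (F k) Vinf \<omega> \<ge> Vinf \<omega>)) \<longrightarrow>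
        (\<exists>\<phi>\<in>Phi \<infinity>. \<exists>K :: 'a \<Rightarrow> enat.
            K \<in> measurable M (count_space UNIV) \<and>
            (\<forall>\<omega>\<in>space M. 0 < K \<omega>) \<and>
            (AE \<omega> in M. K \<omega> < \<infinity>) \<and>
            (\<integral>\<^sup>+\<omega>. tail_sum M F V x K \<omega> \<partial>M)
              \<le> (\<integral>\<^sup>+\<omega>. ennreal (\<phi> (V (x 0 \<omega>) - Vinf \<omega>)) \<partial>M)) \<and>
        (AE \<omega> in M. summable (\<lambda>k. drift_ratio M F V x k \<omega>)))"
proof (intro conjI allI impI)
  have cont: "continuous_on UNIV V"
    using assms(6) unfolding continuously_differentiable_def
    by (simp add: continuous_at_imp_continuous_on differentiable_imp_continuous_within)
  obtain c where c: "\<And>y. c \<le> V y" using bounded_below_coercive[OF assms(5) cont] by blast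
  show "\<exists>Vinf. integrable M Vinf \<and> (AE \<omega> in M. (\<lambda>k. V (x k \<omega>)) \<longlonglongrightarrow> Vinf \<omega>)"
    by (rule supermartingale_bounded_below_converges[OF assms(1-3,12) c])
  fix Vinf
  assume Z: "integrable M Vinf" and lim: "AE \<omega> in M. (\<lambda>k. V (x k \<omega>)) \<longlonglongrightarrow> Vinf \<omega>"
    and grad: "\<forall>k. AE \<omega> in M. 0 < norm (grad V (x k \<omega>))"
    and order: "\<forall>k. (AE \<omega> in M. V (x k \<omega>) \<ge> real_cond_exp M (F k) Vinf \<omega> \<and>
                           real_cond_exp M (F k) Vinf \<omega> > Vinf \<omega>) \<or>
             (AE \<omega> in M. V (x k \<omega>) > real_cond_exp M (F k) Vinf \<omega> \<and>
                           real_cond_exp M (F k) Vinf \<omega> \<ge> Vinf \<omega>)"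
  have ge: "AE \<omega> in M. Vinf \<omega> \<le> real_cond_exp M (F k) Vinf \<omega>" for k
    using order[rule_format, of k] by (elim disjE) (erule eventually_mono, simp)+
  have fixed: "AE \<omega> in M. real_cond_exp M (F k) Vinf \<omega> = Vinf \<omega>" for k
    by (rule real_cond_exp_eq_if_ge[OF assms(1,3) Z ge])
  have above: "AE \<omega> in M. Vinf \<omega> < V (x k \<omega>)" for k
    using order[rule_format, of k] by (elim disjE) (erule eventually_mono, simp)+
  have level: "AE \<omega> in M. Vinf \<omega> \<in> V ` \<Gamma>"
    using lim assms(9)
  proof eventually_elim
    case (elim \<omega>)
    then obtain y where "y \<in> \<Gamma>" "y \<in> accumulation_points (\<lambda>k. x k \<omega>)" by blast
    then show ?case using limit_eq_at_accumulation_point[OF cont _ elim(1)] by blast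
  qed
  obtain \<phi> \<eta> where \<phi>: "\<phi> \<in> Phi \<infinity>" "0 < \<eta>" and
    KL: "\<And>v y. v \<in> V ` \<Gamma> \<Longrightarrow> 0 < V y - v \<Longrightarrow> V y - v < \<eta> \<Longrightarrow> 1 \<le> norm (grad V y) * deriv \<phi> (V y - v)"
    using uniform_KL_above_finite_levels[OF assms(5) cont assms(10,8)] by metis
  have "AE \<omega> in M. V (x k \<omega>) - Vinf \<omega> < \<eta> \<longrightarrow> 1 \<le> norm (grad V (x k \<omega>)) * deriv \<phi> (V (x k \<omega>) - Vinf \<omega>)" for k
    using level above[of k] by eventually_elim (simp add: KL)
  note bound = tail_sum_drift_ratio_le[OF assms(1,3,12) Z lim fixed above grad[rule_format] \<phi> this]
  show "\<exists>\<phi>\<in>Phi \<infinity>. \<exists>K :: 'a \<Rightarrow> enat.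
            K \<in> measurable M (count_space UNIV) \<and>
            (\<forall>\<omega>\<in>space M. 0 < K \<omega>) \<and>
            (AE \<omega> in M. K \<omega> < \<infinity>) \<and>
            (\<integral>\<^sup>+\<omega>. tail_sum M F V x K \<omega> \<partial>M)
              \<le> (\<integral>\<^sup>+\<omega>. ennreal (\<phi> (V (x 0 \<omega>) - Vinf \<omega>)) \<partial>M)"
    using bound \<phi>(1) by blast
  show "AE \<omega> in M. summable (\<lambda>k. drift_ratio M F V x k \<omega>)"
    using bound by blast
qed

end
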